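(* Suppose there exist constants $\lambda,\eta>0$ such that $\lambda\|u\|^2\|v\|^2\le \frac1n\sum_{i=1}^n\langle u,A_iv\rangle^2\le \eta\|u\|^2\|v\|^2$ for all $u,v\in\mathbb{R}^p$. Consider Phase I of the algorithm GRNM described in the context, started at $x^0\in\mathbb{R}^p$. Then: (i) the sequence $\{f(x^k):k=1,\dots,K\}$ is non-increasing, and $\{x^k:k=1,\dots,K\}\subseteq L(f(x^0))$ is bounded, where $L(t)=\{x\in\mathbb{R}^p:f(x)\le t\}$; (ii) the halting condition of Phase I, namely $\|g^K\|<\epsilon_G$ and $K>K_0$, is met with a finite $K$, i.e. $K<+\infty$.
   Context: Setting: $A_1,\dots,A_n\in\mathbb{R}^{p\times p}$ are symmetric, $x^*\in\mathbb{R}^p$, $b_i=\langle x^*,A_ix^*\rangle+\varepsilon_i$ with $\varepsilon_i\in\mathbb{R}$, $f(x)=\frac1{4n}\sum_{i=1}^n(\langle x,A_ix\rangle-b_i)^2$, and $g^k=\nabla f(x^k)$. $\|\cdot\|$ is the Euclidean norm. Phase I of GRNM (gradient descent). Parameters: $\epsilon_G>0$, a finite integer $K_0\ge0$, $\mu_1,\alpha_1\in(0,1)$. Starting with $k=0$: while $\|g^k\|\ge\epsilon_G$ or $k\le K_0$, let $j_k$ be the smallest nonnegative integer with $f(x^k-\alpha_1^{j_k}g^k)\le f(x^k)-\mu_1\alpha_1^{j_k}\|g^k\|^2$, set $\tau_k=\alpha_1^{j_k}$, $x^{k+1}=x^k-\tau_kg^k$, and increase $k$ by 1. $K$ denotes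 the index at which the loop ends ($K=+\infty$ if it never ends). It is assumed that $g^k\neq0$ for every finite $k$ (otherwise the algorithm stops at a stationary point). *)

theory Defs
  imports "HOL-Analysis.Analysis" "HOL-Library.Extended_Nat"
begin

definition least_squares_loss ::
    "nat \<Rightarrow> (nat \<Rightarrow> real ^ 'p ^ 'p) \<Rightarrow> (nat \<Rightarrow> real) \<Rightarrow> real ^ 'p \<Rightarrow> real" where
  "least_squares_loss n A b x =
     1 / (4 * real n) * (\<Sum>i=1..n. (x \<bullet> (A i *v x) - b i)\<^sup>2)"

definition gradient :: "('a::real_inner \<Rightarrow> real) \<Rightarrow> 'a \<Rightarrow> 'a" where
  "gradient f x = (THE D. GDERIV f x :> D)"

lemma gradient_eqI:
  assumes "GDERIV f x :> D"
  shows "gradient f x = D"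
  unfolding gradient_def
proof (rule the_equality[where a = D])
  fix D'
  assume "GDERIV f x :> D'"
  with assms have "(\<lambda>h. h \<bullet> D') = (\<lambda>h. h \<bullet> D)"
    unfolding gderiv_def by (rule has_derivative_unique[rotated])
  then show "D' = D"
    by (metis vector_eq_ldot)
qed (rule assms)

definition sublevel_set :: "('a \<Rightarrow> real) \<Rightarrow> real \<Rightarrow> 'a set" where
  "sublevel_set f t = {x. f x \<le> t}"

text \<open>The backtracking exponent at a point. \<open>LEAST\<close> is only meaningful if some exponent
  satisfies the sufficient decrease condition; for differentiable \<open>f\<close> and
  \<open>\<mu>, \<alpha> \<in> (0, 1)\<close> this is a consequence of Taylor's formula and not an extra assumption.\<close>

definition linesearch_exponent ::
    "real \<Rightarrow> real \<Rightarrow> ('a::real_inner \<Rightarrow> real) \<Rightarrow> 'a \<Rightarrow> nat" where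
  "linesearch_exponent \<mu> \<alpha> f x =
     (LEAST j. f (x - \<alpha> ^ j *\<^sub>R gradient f x) \<le> f x - \<mu> * \<alpha> ^ j * (norm (gradient f x))\<^sup>2)"

text \<open>The gradient iteration is defined for all indices; only the iterates up to the index at
  which the loop ends (\<open>phase1_end\<close> below) are produced by Phase I.\<close>

primrec phase1_iterate ::
    "real \<Rightarrow> real \<Rightarrow> ('a::real_inner \<Rightarrow> real) \<Rightarrow> 'a \<Rightarrow> nat \<Rightarrow> 'a" where
  "phase1_iterate \<mu> \<alpha> f x0 0 = x0"
| "phase1_iterate \<mu> \<alpha> f x0 (Suc k) =
     (let x = phase1_iterate \<mu> \<alpha> f x0 k
      in x - \<alpha> ^ linesearch_exponent \<mu> \<alpha> f x *\<^sub>R gradient f x)"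

definition phase1_continues ::
    "real \<Rightarrow> nat \<Rightarrow> ('a::real_inner \<Rightarrow> real) \<Rightarrow> (nat \<Rightarrow> 'a) \<Rightarrow> nat \<Rightarrow> bool" where
  "phase1_continues \<epsilon>\<^sub>G K\<^sub>0 f x k \<longleftrightarrow> norm (gradient f (x k)) \<ge> \<epsilon>\<^sub>G \<or> k \<le> K\<^sub>0"

definition phase1_end ::
    "real \<Rightarrow> nat \<Rightarrow> ('a::real_inner \<Rightarrow> real) \<Rightarrow> (nat \<Rightarrow> 'a) \<Rightarrow> enat" where
  "phase1_end \<epsilon>\<^sub>G K\<^sub>0 f x =
     (if \<exists>k. \<not> phase1_continues \<epsilon>\<^sub>G K\<^sub>0 f x k
      then enat (LEAST k. \<not> phase1_continues \<epsilon>\<^sub>G K\<^sub>0 f x k) else \<infinity>)"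

end

theory Submission
  imports Defs
begin

text \<open>Why Phase I stops. Along any line the loss is an explicit quartic polynomial, so no second
  derivatives are needed to control a gradient step. With \<open>v\<close> the gradient at \<open>x\<close>, each residual
  at \<open>x - t v\<close> is \<open>r - 2 t p + t\<^sup>2 q\<close>, where \<open>p = \<langle>v, A x\<rangle>\<close> and \<open>q = \<langle>v, A v\<rangle>\<close>. The assumed
  upper bound on the mean of \<open>\<langle>u, A v\<rangle>\<^sup>2\<close> controls the means of \<open>p\<^sup>2\<close> and \<open>q\<^sup>2\<close>, the loss itself is the mean of
  \<open>r\<^sup>2\<close> up to the factor 4, and Cauchy-Schwarz controls the mean of \<open>r q\<close>. Every term of order at
  least two in \<open>t\<close> therefore carries a factor \<open>t\<^sup>2 \<parallel>v\<parallel>\<^sup>2\<close>, with a coefficient that depends only on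
  the loss, on \<open>\<parallel>x\<parallel>\<close> and on \<open>\<parallel>v\<parallel>\<close> (\<open>least_squares_loss_gradient_step\<close>).

  The lower bound makes the loss grow like \<open>\<parallel>x\<parallel>\<^sup>4\<close>, so its sublevel sets are bounded
  (\<open>bounded_sublevel_least_squares_loss\<close>), and a bound on the gradient in terms of \<open>\<parallel>x\<parallel>\<close> and the
  loss follows by another use of Cauchy-Schwarz (\<open>norm_gradient_least_squares_loss_le\<close>). On the
  initial sublevel set the coefficient above is thus at most one constant \<open>C\<close>.

  As soon as \<open>C \<alpha>\<^sup>J \<le> 1 - \<mu>\<close>, the step size \<open>\<alpha>\<^sup>J\<close> passes the line search at every point of that
  set (\<open>uniform_backtracking_exponent\<close>). Backtracking then never goes beyond \<open>J\<close>, so the iterates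
  stay in the set and every iteration lowers the loss by at least \<open>\<mu> \<alpha>\<^sup>J\<close> times the squared gradient
  norm. While the gradient norm is at least \<open>\<epsilon>\<^sub>G\<close> this is a fixed positive amount, and a
  nonnegative loss can pay it only finitely often (\<open>phase1_halts\<close>).\<close>

section \<open>Backtracking gradient descent under a uniform quadratic upper bound\<close>

lemma linesearch_decrease:
  assumes "f (x - \<alpha> ^ J *\<^sub>R gradient f x) \<le> f x - \<mu> * \<alpha> ^ J * (norm (gradient f x))\<^sup>2"
  shows "linesearch_exponent \<mu> \<alpha> f x \<le> J"
    and "f (x - \<alpha> ^ linesearch_exponent \<mu> \<alpha> f x *\<^sub>R gradient f x)
           \<le> f x - \<mu> * \<alpha> ^ linesearch_exponent \<mu> \<alpha> f x * (norm (gradient f x))\<^sup>2"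
  unfolding linesearch_exponent_def by (rule Least_le LeastI, rule assms)+

text \<open>One exponent that works on all of \<open>S\<close> replaces the usual lower bound
  \<open>min 1 (\<alpha> (1 - \<mu>) / C)\<close> on the step sizes: minimality of the line search exponent then gives
  step sizes of at least \<open>\<alpha> ^ J\<close>, without looking at the last rejected trial step.\<close>

lemma uniform_backtracking_exponent:
  fixes f :: "'a::real_inner \<Rightarrow> real"
  assumes "0 < \<alpha>" "\<alpha> < 1" "\<mu> < 1"
    and quad: "\<And>x t. x \<in> S \<Longrightarrow> 0 \<le> t \<Longrightarrow> t \<le> 1 \<Longrightarrow>
      f (x - t *\<^sub>R gradient f x)
        \<le> f x - t * (norm (gradient f x))\<^sup>2 + C * t\<^sup>2 * (norm (gradient f x))\<^sup>2"
  obtains J where "\<And>x. x \<in> S \<Longrightarrow>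
      f (x - \<alpha> ^ J *\<^sub>R gradient f x) \<le> f x - \<mu> * \<alpha> ^ J * (norm (gradient f x))\<^sup>2"
proof -
  \<comment> \<open>Enlarging \<open>C\<close> to at least 1 avoids a case distinction on its sign in the division.\<close>
  define D where "D = max C 1"
  have "D > 0" "C \<le> D" by (auto simp: D_def)
  obtain J where J: "\<alpha> ^ J < (1 - \<mu>) / D"
    using real_arch_pow_inv[of "(1 - \<mu>) / D" \<alpha>] assms \<open>D > 0\<close> by auto
  have small: "C * \<alpha> ^ J \<le> 1 - \<mu>"
  proof -
    have "C * \<alpha> ^ J \<le> D * \<alpha> ^ J"
      using \<open>C \<le> D\<close> assms(1) by (intro mult_right_mono) auto
    also have "\<dots> \<le> 1 - \<mu>" using J \<open>D > 0\<close> by (simp add: field_simps)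
    finally show ?thesis .
  qed
  show thesis
  proof (rule that[of J])
    fix x assume "x \<in> S"
    let ?t = "\<alpha> ^ J" and ?N = "(norm (gradient f x))\<^sup>2"
    have "(C * ?t) * (?t * ?N) \<le> (1 - \<mu>) * (?t * ?N)"
      using small assms(1) by (intro mult_right_mono) auto
    then have "f x - ?t * ?N + C * ?t\<^sup>2 * ?N \<le> f x - \<mu> * ?t * ?N"
      by (simp add: algebra_simps power2_eq_square)
    moreover have "f (x - ?t *\<^sub>R gradient f x) \<le> f x - ?t * ?N + C * ?t\<^sup>2 * ?N"
      using \<open>x \<in> S\<close> assms(1,2) by (intro quad) (auto intro: power_le_one)
    ultimately show "f (x - ?t *\<^sub>R gradient f x) \<le> f x - \<mu> * ?t * ?N" by linarith
  qed
qed

text \<open>The two claims depend on each other: the decrease at \<open>x k\<close> needs \<open>x k\<close> to lie in the initial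
  sublevel set, where \<open>J\<close> is acceptable, and the decrease is what keeps \<open>x (Suc k)\<close> there.\<close>

lemma phase1_iterate_decrease:
  fixes f :: "'a::real_inner \<Rightarrow> real"
  assumes "0 < \<mu>" "0 < \<alpha>" "\<alpha> < 1"
    and acc: "\<And>x. x \<in> sublevel_set f (f x0) \<Longrightarrow>
      f (x - \<alpha> ^ J *\<^sub>R gradient f x) \<le> f x - \<mu> * \<alpha> ^ J * (norm (gradient f x))\<^sup>2"
  defines "x \<equiv> phase1_iterate \<mu> \<alpha> f x0"
  shows "x k \<in> sublevel_set f (f x0)"
    and "f (x (Suc k)) \<le> f (x k) - \<mu> * \<alpha> ^ J * (norm (gradient f (x k)))\<^sup>2"
proof -
  have step: "f (x (Suc k)) \<le> f (x k) - \<mu> * \<alpha> ^ J * (norm (gradient f (x k)))\<^sup>2"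
    if "x k \<in> sublevel_set f (f x0)" for k
  proof -
    let ?j = "linesearch_exponent \<mu> \<alpha> f (x k)"
    have "\<alpha> ^ J \<le> \<alpha> ^ ?j"
      using linesearch_decrease(1)[OF acc[OF that]] assms(2,3) by (intro power_decreasing) auto
    then have "\<mu> * \<alpha> ^ J * (norm (gradient f (x k)))\<^sup>2 \<le> \<mu> * \<alpha> ^ ?j * (norm (gradient f (x k)))\<^sup>2"
      using assms(1) by (intro mult_right_mono mult_left_mono) auto
    with linesearch_decrease(2)[OF acc[OF that]] show ?thesis
      by (simp add: x_def Let_def)
  qed
  have mem: "x k \<in> sublevel_set f (f x0)" for k
  proof (induction k)
    case 0
    then show ?case by (simp add: x_def sublevel_set_def)
  next
    case (Suc k)
    have "0 \<le> \<mu> * \<alpha> ^ J * (norm (gradient f (x k)))\<^sup>2" using assms(1,2) by simp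
    with step[OF Suc] Suc show ?case by (auto simp: sublevel_set_def)
  qed
  then show "x k \<in> sublevel_set f (f x0)" .
  show "f (x (Suc k)) \<le> f (x k) - \<mu> * \<alpha> ^ J * (norm (gradient f (x k)))\<^sup>2"
    by (rule step[OF mem])
qed

text \<open>If the loop never ended, then every index beyond \<open>K\<^sub>0\<close> would have gradient norm at least
  \<open>\<epsilon>\<^sub>G\<close>, and the values would fall at least linearly, below every bound.\<close>

lemma phase1_halts:
  fixes f :: "'a::real_inner \<Rightarrow> real" and x :: "nat \<Rightarrow> 'a"
  assumes "0 < c" "0 < \<epsilon>\<^sub>G"
    and dec: "\<And>k. f (x (Suc k)) \<le> f (x k) - c * (norm (gradient f (x k)))\<^sup>2"
    and below: "\<And>k. B \<le> f (x k)"
  shows "\<exists>m. phase1_end \<epsilon>\<^sub>G K\<^sub>0 f x = enat m \<and> norm (gradient f (x m)) < \<epsilon>\<^sub>G \<and> K\<^sub>0 < m"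
proof -
  let ?cont = "phase1_continues \<epsilon>\<^sub>G K\<^sub>0 f x"
  have "\<exists>k. \<not> ?cont k"
  proof (rule ccontr)
    assume "\<nexists>k. \<not> ?cont k"
    then have big: "\<epsilon>\<^sub>G \<le> norm (gradient f (x k))" if "K\<^sub>0 < k" for k
      using that by (meson not_le phase1_continues_def)
    define s where "s = Suc K\<^sub>0"
    have drop: "f (x (s + m)) \<le> f (x s) - real m * (c * \<epsilon>\<^sub>G\<^sup>2)" for m
    proof (induction m)
      case (Suc m)
      have "\<epsilon>\<^sub>G\<^sup>2 \<le> (norm (gradient f (x (s + m))))\<^sup>2"
        using big[of "s + m"] assms(2) by (intro power_mono) (auto simp: s_def)
      then have "c * \<epsilon>\<^sub>G\<^sup>2 \<le> c * (norm (gradient f (x (s + m))))\<^sup>2"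
        using assms(1) by (intro mult_left_mono) auto
      with dec[of "s + m"] Suc show ?case by (simp add: algebra_simps)
    qed simp
    obtain m where "f (x s) - B < real m * (c * \<epsilon>\<^sub>G\<^sup>2)"
      using reals_Archimedean3[of "c * \<epsilon>\<^sub>G\<^sup>2"] assms(1,2) by auto
    with drop[of m] below[of "s + m"] show False by linarith
  qed
  from LeastI_ex[OF this] this show ?thesis
    by (auto simp: phase1_end_def phase1_continues_def not_le)
qed

section \<open>The quartic loss\<close>

lemma inner_symmetric_matrix_commute:
  fixes A :: "real ^ 'p ^ 'p"
  assumes "transpose A = A"
  shows "u \<bullet> (A *v v) = v \<bullet> (A *v u)"
  by (metis assms dot_lmul_matrix inner_commute transpose_matrix_vector)

lemma least_squares_loss_nonneg: "0 \<le> least_squares_loss n A b x"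
  by (simp add: least_squares_loss_def sum_nonneg)

lemma GDERIV_least_squares_loss:
  fixes A :: "nat \<Rightarrow> real ^ 'p ^ 'p"
  assumes sym: "\<And>i. i \<in> {1..n} \<Longrightarrow> transpose (A i) = A i"
  shows "GDERIV (least_squares_loss n A b) x :>
    (1 / real n) *\<^sub>R (\<Sum>i=1..n. (x \<bullet> (A i *v x) - b i) *\<^sub>R (A i *v x))"
proof -
  have lin: "((\<lambda>y. A i *v y) has_derivative (\<lambda>h. A i *v h)) (at x)" for i
    using bounded_linear.has_derivative[OF matrix_vector_mul_bounded_linear has_derivative_ident] .
  have residual: "((\<lambda>y. (y \<bullet> (A i *v y) - b i)\<^sup>2) has_derivative
      (\<lambda>h. 2 * (x \<bullet> (A i *v x) - b i) * (x \<bullet> (A i *v h) + h \<bullet> (A i *v x)))) (at x)" for i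
    by (auto intro!: derivative_eq_intros lin simp: algebra_simps)
  have "((\<lambda>y. 1 / (4 * real n) * (\<Sum>i=1..n. (y \<bullet> (A i *v y) - b i)\<^sup>2)) has_derivative
      (\<lambda>h. 1 / (4 * real n) * (\<Sum>i=1..n. 2 * (x \<bullet> (A i *v x) - b i) * (x \<bullet> (A i *v h) + h \<bullet> (A i *v x)))))
      (at x)"
    by (intro has_derivative_mult_right has_derivative_sum residual)
  moreover have "(\<lambda>h. 1 / (4 * real n) * (\<Sum>i=1..n. 2 * (x \<bullet> (A i *v x) - b i) * (x \<bullet> (A i *v h) + h \<bullet> (A i *v x)))) =
      (\<lambda>h. h \<bullet> ((1 / real n) *\<^sub>R (\<Sum>i=1..n. (x \<bullet> (A i *v x) - b i) *\<^sub>R (A i *v x))))" (is "?l = ?r")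
  proof
    fix h
    have "(\<Sum>i=1..n. 2 * (x \<bullet> (A i *v x) - b i) * (x \<bullet> (A i *v h) + h \<bullet> (A i *v x))) =
        (\<Sum>i=1..n. 4 * ((x \<bullet> (A i *v x) - b i) * (h \<bullet> (A i *v x))))"
      by (intro sum.cong refl) (simp add: inner_symmetric_matrix_commute[OF sym, of _ x h])
    then show "?l h = ?r h"
      by (cases "n = 0") (simp_all add: sum_distrib_left[symmetric] inner_sum_right)
  qed
  ultimately show ?thesis
    unfolding gderiv_def least_squares_loss_def[abs_def] by simp
qed

lemma mean_mult_le:
  fixes u v :: "nat \<Rightarrow> real"
  assumes "1 / real n * (\<Sum>i=1..n. (u i)\<^sup>2) \<le> U\<^sup>2" "1 / real n * (\<Sum>i=1..n. (v i)\<^sup>2) \<le> V\<^sup>2"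
    and "0 \<le> U" "0 \<le> V"
  shows "1 / real n * (\<Sum>i=1..n. u i * v i) \<le> U * V"
proof (rule power2_le_imp_le)
  have "(1 / real n * (\<Sum>i=1..n. u i * v i))\<^sup>2 \<le>
      (1 / real n)\<^sup>2 * ((\<Sum>i=1..n. (u i)\<^sup>2) * (\<Sum>i=1..n. (v i)\<^sup>2))"
    unfolding power_mult_distrib by (intro mult_left_mono Cauchy_Schwarz_ineq_sum) auto
  also have "\<dots> = (1 / real n * (\<Sum>i=1..n. (u i)\<^sup>2)) * (1 / real n * (\<Sum>i=1..n. (v i)\<^sup>2))"
    by (simp add: power2_eq_square)
  also have "\<dots> \<le> U\<^sup>2 * V\<^sup>2"
    using assms by (intro mult_mono) (auto simp: sum_nonneg)
  finally show "(1 / real n * (\<Sum>i=1..n. u i * v i))\<^sup>2 \<le> (U * V)\<^sup>2"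
    by (simp add: power_mult_distrib)
qed (use assms in auto)

text \<open>This is \<open>a\<^sup>2 \<le> 2 (a - b)\<^sup>2 + 2 b\<^sup>2\<close> averaged over the measurements: a small loss forces the
  quadratic forms at \<open>x\<close> to be close to the data, hence bounded in the mean.\<close>

lemma least_squares_loss_coercive:
  fixes A :: "nat \<Rightarrow> real ^ 'p ^ 'p"
  assumes lower: "lam * (norm x)\<^sup>2 * (norm x)\<^sup>2 \<le> 1 / real n * (\<Sum>i=1..n. (x \<bullet> (A i *v x))\<^sup>2)"
  shows "lam * (norm x) ^ 4 \<le>
    8 * least_squares_loss n A b x + 2 * (1 / real n * (\<Sum>i=1..n. (b i)\<^sup>2))"
proof -
  have "(x \<bullet> (A i *v x))\<^sup>2 \<le> 2 * (x \<bullet> (A i *v x) - b i)\<^sup>2 + 2 * (b i)\<^sup>2" for i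
    using zero_le_power2[of "x \<bullet> (A i *v x) - 2 * b i"]
    by (simp add: power2_eq_square algebra_simps)
  then have "(\<Sum>i=1..n. (x \<bullet> (A i *v x))\<^sup>2) \<le>
      2 * (\<Sum>i=1..n. (x \<bullet> (A i *v x) - b i)\<^sup>2) + 2 * (\<Sum>i=1..n. (b i)\<^sup>2)"
    unfolding sum_distrib_left sum.distrib[symmetric] by (intro sum_mono) auto
  then have "1 / real n * (\<Sum>i=1..n. (x \<bullet> (A i *v x))\<^sup>2) \<le>
      1 / real n * (2 * (\<Sum>i=1..n. (x \<bullet> (A i *v x) - b i)\<^sup>2) + 2 * (\<Sum>i=1..n. (b i)\<^sup>2))"
    by (intro mult_left_mono) auto
  also have "\<dots> = 8 * least_squares_loss n A b x + 2 * (1 / real n * (\<Sum>i=1..n. (b i)\<^sup>2))"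
    by (cases "n = 0") (simp_all add: least_squares_loss_def field_simps)
  finally show ?thesis
    using lower by (simp add: power4_eq_xxxx power2_eq_square mult.assoc)
qed

lemma bounded_sublevel_least_squares_loss:
  fixes A :: "nat \<Rightarrow> real ^ 'p ^ 'p"
  assumes "0 < lam"
    and lower: "\<And>x. lam * (norm x)\<^sup>2 * (norm x)\<^sup>2 \<le> 1 / real n * (\<Sum>i=1..n. (x \<bullet> (A i *v x))\<^sup>2)"
  shows "bounded (sublevel_set (least_squares_loss n A b) c)"
proof -
  define M where "M = (8 * c + 2 * (1 / real n * (\<Sum>i=1..n. (b i)\<^sup>2))) / lam"
  have "norm x \<le> max 1 M" if "x \<in> sublevel_set (least_squares_loss n A b) c" for x
  proof (cases "norm x \<le> 1")
    case False
    have "lam * (norm x) ^ 4 \<le> lam * M"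
      using least_squares_loss_coercive[where b = b, OF lower, of x] that assms(1)
      by (simp add: M_def sublevel_set_def)
    then have "(norm x) ^ 4 \<le> M" using assms(1) by simp
    moreover have "norm x \<le> (norm x) ^ 4"
      using False by (intro self_le_power) auto
    ultimately show ?thesis by simp
  qed simp
  then show ?thesis unfolding bounded_iff by blast
qed

text \<open>The gradient \<open>g\<close> is the mean of \<open>r A x\<close>, so \<open>\<parallel>g\<parallel>\<^sup>2\<close> is the mean of \<open>r \<langle>g, A x\<rangle>\<close>. By Cauchy-Schwarz
  that is at most a constant times \<open>\<parallel>g\<parallel>\<close>, and one factor \<open>\<parallel>g\<parallel>\<close> cancels. This avoids bounding the
  individual matrices, about which only the averaged estimate is given.\<close>

lemma norm_gradient_least_squares_loss_le:
  fixes A :: "nat \<Rightarrow> real ^ 'p ^ 'p"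
  assumes sym: "\<And>i. i \<in> {1..n} \<Longrightarrow> transpose (A i) = A i"
    and "0 \<le> \<eta>"
    and upper: "\<And>u v. 1 / real n * (\<Sum>i=1..n. (u \<bullet> (A i *v v))\<^sup>2) \<le> \<eta> * (norm u)\<^sup>2 * (norm v)\<^sup>2"
  shows "norm (gradient (least_squares_loss n A b) x)
    \<le> 2 * sqrt (\<eta> * least_squares_loss n A b x) * norm x"
proof -
  let ?F = "least_squares_loss n A b x"
  define r where "r = (\<lambda>i. x \<bullet> (A i *v x) - b i)"
  define g where "g = gradient (least_squares_loss n A b) x"
  have g: "g = (1 / real n) *\<^sub>R (\<Sum>i=1..n. r i *\<^sub>R (A i *v x))"
    unfolding g_def r_def by (intro gradient_eqI GDERIV_least_squares_loss sym)
  have "(norm g)\<^sup>2 = g \<bullet> ((1 / real n) *\<^sub>R (\<Sum>i=1..n. r i *\<^sub>R (A i *v x)))"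
    using g by (metis power2_norm_eq_inner)
  also have "\<dots> = 1 / real n * (\<Sum>i=1..n. r i * (g \<bullet> (A i *v x)))"
    by (simp add: inner_sum_right)
  also have "\<dots> \<le> (2 * sqrt ?F) * (sqrt \<eta> * norm g * norm x)"
  proof (rule mean_mult_le)
    show "1 / real n * (\<Sum>i=1..n. (r i)\<^sup>2) \<le> (2 * sqrt ?F)\<^sup>2"
      using least_squares_loss_nonneg[of n A b x]
      by (simp add: power_mult_distrib least_squares_loss_def r_def)
    show "1 / real n * (\<Sum>i=1..n. (g \<bullet> (A i *v x))\<^sup>2) \<le> (sqrt \<eta> * norm g * norm x)\<^sup>2"
      using upper[of g x] assms(2) by (simp add: power_mult_distrib)
  qed (use assms(2) least_squares_loss_nonneg in auto)
  finally have "norm g * norm g \<le> (2 * sqrt (\<eta> * ?F) * norm x) * norm g"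
    by (simp add: power2_eq_square real_sqrt_mult mult_ac)
  then show ?thesis
    unfolding g_def[symmetric]
    by (cases "norm g = 0") (use assms(2) least_squares_loss_nonneg[of n A b x] in auto)
qed

text \<open>This plays the role of the descent lemma for a Lipschitz continuous gradient. The three
  summands of the coefficient of \<open>t\<^sup>2\<close> come from the means of \<open>p\<^sup>2\<close>, \<open>q\<^sup>2\<close> and \<open>r q\<close>, in this
  order, where \<open>p = \<langle>g, A x\<rangle>\<close> and \<open>q = \<langle>g, A g\<rangle>\<close> are the coefficients of \<open>-2 t\<close> and \<open>t\<^sup>2\<close> in the
  residual along the step.\<close>

lemma least_squares_loss_gradient_step:
  fixes A :: "nat \<Rightarrow> real ^ 'p ^ 'p" and b :: "nat \<Rightarrow> real" and x :: "real ^ 'p"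
  assumes sym: "\<And>i. i \<in> {1..n} \<Longrightarrow> transpose (A i) = A i"
    and "0 \<le> \<eta>"
    and upper: "\<And>u v. 1 / real n * (\<Sum>i=1..n. (u \<bullet> (A i *v v))\<^sup>2) \<le> \<eta> * (norm u)\<^sup>2 * (norm v)\<^sup>2"
    and "0 \<le> t" "t \<le> 1"
  defines "f \<equiv> least_squares_loss n A b"
  defines "g \<equiv> gradient f x"
  shows "f (x - t *\<^sub>R g) \<le> f x - t * (norm g)\<^sup>2
    + (2 * \<eta> * (norm x)\<^sup>2 + \<eta> * (norm g)\<^sup>2 / 2 + sqrt (\<eta> * f x)) * t\<^sup>2 * (norm g)\<^sup>2"
proof -
  define r where "r = (\<lambda>i. x \<bullet> (A i *v x) - b i)"
  define p where "p = (\<lambda>i. g \<bullet> (A i *v x))"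
  define q where "q = (\<lambda>i. g \<bullet> (A i *v g))"
  have F0: "0 \<le> f x" unfolding f_def by (rule least_squares_loss_nonneg)
  have g: "g = (1 / real n) *\<^sub>R (\<Sum>i=1..n. r i *\<^sub>R (A i *v x))"
    unfolding g_def f_def r_def by (intro gradient_eqI GDERIV_least_squares_loss sym)
  have slope: "1 / real n * (\<Sum>i=1..n. r i * p i) = (norm g)\<^sup>2"
  proof -
    have "1 / real n * (\<Sum>i=1..n. r i * p i) = g \<bullet> ((1 / real n) *\<^sub>R (\<Sum>i=1..n. r i *\<^sub>R (A i *v x)))"
      by (simp add: inner_sum_right p_def)
    then show ?thesis using g by (metis power2_norm_eq_inner)
  qed
  have pp: "1 / real n * (\<Sum>i=1..n. (p i)\<^sup>2) \<le> \<eta> * (norm g)\<^sup>2 * (norm x)\<^sup>2"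
    unfolding p_def by (rule upper)
  have qq: "1 / real n * (\<Sum>i=1..n. (q i)\<^sup>2) \<le> \<eta> * (norm g)\<^sup>2 * (norm g)\<^sup>2"
    unfolding q_def by (rule upper)
  have rq: "1 / real n * (\<Sum>i=1..n. r i * q i) \<le> (2 * sqrt (f x)) * (sqrt \<eta> * norm g * norm g)"
  proof (rule mean_mult_le)
    show "1 / real n * (\<Sum>i=1..n. (r i)\<^sup>2) \<le> (2 * sqrt (f x))\<^sup>2"
      using F0 by (simp add: power_mult_distrib f_def least_squares_loss_def r_def)
    show "1 / real n * (\<Sum>i=1..n. (q i)\<^sup>2) \<le> (sqrt \<eta> * norm g * norm g)\<^sup>2"
      using qq assms(2) by (simp add: power_mult_distrib)
  qed (use assms(2) F0 in auto)
  have residual: "(x - t *\<^sub>R g) \<bullet> (A i *v (x - t *\<^sub>R g)) - b i = r i - 2 * t * p i + t\<^sup>2 * q i"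
    if "i \<in> {1..n}" for i
    using inner_symmetric_matrix_commute[OF sym[OF that], of x g]
    by (simp add: r_def p_def q_def matrix_vector_mult_diff_distrib matrix_vector_mult_scaleR
        inner_diff_left inner_diff_right power2_eq_square algebra_simps)
  \<comment> \<open>Collecting the terms of order at least two as \<open>t\<^sup>2 ((2 p - t q)\<^sup>2 + 2 r q)\<close> absorbs the cubic
    one into a square; the bound \<open>t \<le> 1\<close> turns the quartic term into a quadratic one.\<close>
  have square: "(r i - 2 * t * p i + t\<^sup>2 * q i)\<^sup>2 \<le>
      (r i)\<^sup>2 - 4 * t * (r i * p i) + t\<^sup>2 * (8 * (p i)\<^sup>2 + 2 * (q i)\<^sup>2 + 2 * (r i * q i))" for i
  proof -
    have "(2 * p i - t * q i)\<^sup>2 \<le> 8 * (p i)\<^sup>2 + 2 * t\<^sup>2 * (q i)\<^sup>2"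
      using zero_le_power2[of "2 * p i + t * q i"] by (simp add: power2_eq_square algebra_simps)
    also have "t\<^sup>2 * (q i)\<^sup>2 \<le> 1 * (q i)\<^sup>2"
      using assms(4,5) by (intro mult_right_mono) (auto intro: power_le_one)
    then have "8 * (p i)\<^sup>2 + 2 * t\<^sup>2 * (q i)\<^sup>2 \<le> 8 * (p i)\<^sup>2 + 2 * (q i)\<^sup>2" by simp
    finally have "t\<^sup>2 * (2 * p i - t * q i)\<^sup>2 \<le> t\<^sup>2 * (8 * (p i)\<^sup>2 + 2 * (q i)\<^sup>2)"
      by (intro mult_left_mono) auto
    then show ?thesis by (simp add: power2_eq_square algebra_simps)
  qed
  have expand_sum: "(\<Sum>i=1..n. (r i)\<^sup>2 - 4 * t * (r i * p i)
      + t\<^sup>2 * (8 * (p i)\<^sup>2 + 2 * (q i)\<^sup>2 + 2 * (r i * q i))) =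
    (\<Sum>i=1..n. (r i)\<^sup>2) - 4 * t * (\<Sum>i=1..n. r i * p i)
      + t\<^sup>2 * (8 * (\<Sum>i=1..n. (p i)\<^sup>2) + 2 * (\<Sum>i=1..n. (q i)\<^sup>2) + 2 * (\<Sum>i=1..n. r i * q i))"
    by (simp add: sum.distrib sum_subtractf sum_distrib_left distrib_left)
  have "f (x - t *\<^sub>R g) = 1 / (4 * real n) * (\<Sum>i=1..n. (r i - 2 * t * p i + t\<^sup>2 * q i)\<^sup>2)"
    using residual by (simp add: f_def least_squares_loss_def)
  also have "\<dots> \<le> 1 / (4 * real n) * (\<Sum>i=1..n. (r i)\<^sup>2 - 4 * t * (r i * p i)
      + t\<^sup>2 * (8 * (p i)\<^sup>2 + 2 * (q i)\<^sup>2 + 2 * (r i * q i)))"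
    by (intro mult_left_mono sum_mono square) auto
  also have "\<dots> = 1 / (4 * real n) * (\<Sum>i=1..n. (r i)\<^sup>2) - t * (1 / real n * (\<Sum>i=1..n. r i * p i))
      + t\<^sup>2 * (2 * (1 / real n * (\<Sum>i=1..n. (p i)\<^sup>2)) + 1 / 2 * (1 / real n * (\<Sum>i=1..n. (q i)\<^sup>2))
        + 1 / 2 * (1 / real n * (\<Sum>i=1..n. r i * q i)))"
    unfolding expand_sum by (cases "n = 0") (simp_all add: field_simps)
  also have "\<dots> \<le> f x - t * (norm g)\<^sup>2
      + t\<^sup>2 * (2 * (\<eta> * (norm g)\<^sup>2 * (norm x)\<^sup>2) + 1 / 2 * (\<eta> * (norm g)\<^sup>2 * (norm g)\<^sup>2)
        + 1 / 2 * ((2 * sqrt (f x)) * (sqrt \<eta> * norm g * norm g)))"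
    unfolding slope
    by (intro add_mono mult_left_mono diff_mono pp qq rq)
      (simp_all add: \<open>0 \<le> t\<close> f_def least_squares_loss_def r_def)
  also have "\<dots> = f x - t * (norm g)\<^sup>2
    + (2 * \<eta> * (norm x)\<^sup>2 + \<eta> * (norm g)\<^sup>2 / 2 + sqrt (\<eta> * f x)) * t\<^sup>2 * (norm g)\<^sup>2"
    by (simp add: real_sqrt_mult power2_eq_square algebra_simps)
  finally show ?thesis .
qed

theorem lemma4p3:
  fixes n :: nat
    and A :: "nat \<Rightarrow> real ^ 'p ^ 'p"
    and xstar x0 :: "real ^ 'p"
    and b \<epsilon> :: "nat \<Rightarrow> real"
    and \<epsilon>\<^sub>G \<mu>\<^sub>1 \<alpha>\<^sub>1 lam \<eta> :: real
    and K\<^sub>0 :: nat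
    and f :: "real ^ 'p \<Rightarrow> real"
    and x g :: "nat \<Rightarrow> real ^ 'p"
    and K :: enat
  assumes n_pos: "n \<ge> 1"
    and symmetric: "\<And>i. i \<in> {1..n} \<Longrightarrow> transpose (A i) = A i"
    and b_eq: "\<And>i. i \<in> {1..n} \<Longrightarrow> b i = xstar \<bullet> (A i *v xstar) + \<epsilon> i"
    and f_eq: "f = least_squares_loss n A b"
    and \<epsilon>\<^sub>G_pos: "\<epsilon>\<^sub>G > 0"
    and \<mu>\<^sub>1_bounds: "0 < \<mu>\<^sub>1" "\<mu>\<^sub>1 < 1"
    and \<alpha>\<^sub>1_bounds: "0 < \<alpha>\<^sub>1" "\<alpha>\<^sub>1 < 1"
    and x_eq: "x = phase1_iterate \<mu>\<^sub>1 \<alpha>\<^sub>1 f x0"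
    and g_eq: "\<And>k. g k = gradient f (x k)"
    and K_eq: "K = phase1_end \<epsilon>\<^sub>G K\<^sub>0 f x"
    and nonstationary: "\<And>k. enat k \<le> K \<Longrightarrow> g k \<noteq> 0"
    and lam_pos: "lam > 0"
    and \<eta>_pos: "\<eta> > 0"
    and lower: "\<And>u v. lam * (norm u)\<^sup>2 * (norm v)\<^sup>2 \<le> 1 / real n * (\<Sum>i=1..n. (u \<bullet> (A i *v v))\<^sup>2)"
    and upper: "\<And>u v. 1 / real n * (\<Sum>i=1..n. (u \<bullet> (A i *v v))\<^sup>2) \<le> \<eta> * (norm u)\<^sup>2 * (norm v)\<^sup>2"
  shows "((\<forall>k l. 1 \<le> k \<and> k \<le> l \<and> enat l \<le> K \<longrightarrow> f (x l) \<le> f (x k))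
          \<and> {x k | k. 1 \<le> k \<and> enat k \<le> K} \<subseteq> sublevel_set f (f x0)
          \<and> bounded {x k | k. 1 \<le> k \<and> enat k \<le> K}
          \<and> bounded (sublevel_set f (f x0)))
       \<and> (K < \<infinity> \<and> (\<exists>m. K = enat m \<and> norm (g m) < \<epsilon>\<^sub>G \<and> m > K\<^sub>0))"
proof -
  have gradient_step: "f (y - t *\<^sub>R gradient f y) \<le> f y - t * (norm (gradient f y))\<^sup>2
      + (2 * \<eta> * (norm y)\<^sup>2 + \<eta> * (norm (gradient f y))\<^sup>2 / 2 + sqrt (\<eta> * f y))
        * t\<^sup>2 * (norm (gradient f y))\<^sup>2" if "0 \<le> t" "t \<le> 1" for y t
    using symmetric upper \<eta>_pos that
    unfolding f_eq by (intro least_squares_loss_gradient_step) auto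
  have gradient_bound: "norm (gradient f y) \<le> 2 * sqrt (\<eta> * f y) * norm y" for y
    using symmetric upper \<eta>_pos
    unfolding f_eq by (intro norm_gradient_least_squares_loss_le) auto
  have nonneg: "0 \<le> f y" for y
    unfolding f_eq by (rule least_squares_loss_nonneg)
  have level_bounded: "bounded (sublevel_set f (f x0))"
    unfolding f_eq by (rule bounded_sublevel_least_squares_loss[OF lam_pos lower])
  then obtain R where R: "0 < R" "\<And>y. y \<in> sublevel_set f (f x0) \<Longrightarrow> norm y \<le> R"
    unfolding bounded_pos by blast
  \<comment> \<open>\<open>\<gamma>\<close> bounds the gradient norm on the initial sublevel set, and \<open>C\<close> the coefficient of \<open>t\<^sup>2\<close>.\<close>
  define \<gamma> where "\<gamma> = 2 * sqrt (\<eta> * f x0) * R"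
  define C where "C = 2 * \<eta> * R\<^sup>2 + \<eta> * \<gamma>\<^sup>2 / 2 + sqrt (\<eta> * f x0)"
  have quad: "f (y - t *\<^sub>R gradient f y)
      \<le> f y - t * (norm (gradient f y))\<^sup>2 + C * t\<^sup>2 * (norm (gradient f y))\<^sup>2"
    if y: "y \<in> sublevel_set f (f x0)" and t: "0 \<le> t" "t \<le> 1" for y t
  proof -
    have le: "\<eta> * f y \<le> \<eta> * f x0"
      using y \<eta>_pos by (simp add: sublevel_set_def)
    have "2 * sqrt (\<eta> * f y) * norm y \<le> \<gamma>"
      unfolding \<gamma>_def using le R(2)[OF y] nonneg[of x0] nonneg[of y] \<eta>_pos by (intro mult_mono) auto
    with gradient_bound[of y] have g: "norm (gradient f y) \<le> \<gamma>" by linarith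
    have "2 * \<eta> * (norm y)\<^sup>2 + \<eta> * (norm (gradient f y))\<^sup>2 / 2 + sqrt (\<eta> * f y) \<le> C"
      unfolding C_def using le g R(2)[OF y] \<eta>_pos
      by (intro add_mono divide_right_mono mult_left_mono power_mono) auto
    then have "(2 * \<eta> * (norm y)\<^sup>2 + \<eta> * (norm (gradient f y))\<^sup>2 / 2 + sqrt (\<eta> * f y))
        * t\<^sup>2 * (norm (gradient f y))\<^sup>2 \<le> C * t\<^sup>2 * (norm (gradient f y))\<^sup>2"
      by (intro mult_right_mono) auto
    with gradient_step[OF t, of y] show ?thesis by linarith
  qed
  obtain J where J: "\<And>y. y \<in> sublevel_set f (f x0) \<Longrightarrow>
      f (y - \<alpha>\<^sub>1 ^ J *\<^sub>R gradient f y) \<le> f y - \<mu>\<^sub>1 * \<alpha>\<^sub>1 ^ J * (norm (gradient f y))\<^sup>2"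
    using uniform_backtracking_exponent[OF \<alpha>\<^sub>1_bounds \<mu>\<^sub>1_bounds(2) quad] by blast
  have iterates: "x k \<in> sublevel_set f (f x0)"
      "f (x (Suc k)) \<le> f (x k) - \<mu>\<^sub>1 * \<alpha>\<^sub>1 ^ J * (norm (gradient f (x k)))\<^sup>2" for k
    using phase1_iterate_decrease[of \<mu>\<^sub>1 \<alpha>\<^sub>1 f x0 J k] \<mu>\<^sub>1_bounds(1) \<alpha>\<^sub>1_bounds J
    unfolding x_eq by blast+
  have decr: "f (x (Suc k)) \<le> f (x k)" for k
  proof -
    have "0 \<le> \<mu>\<^sub>1 * \<alpha>\<^sub>1 ^ J * (norm (gradient f (x k)))\<^sup>2"
      using \<mu>\<^sub>1_bounds \<alpha>\<^sub>1_bounds by simp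
    with iterates(2)[of k] show ?thesis by linarith
  qed
  have "f (x l) \<le> f (x k)" if "k \<le> l" for k l
    using lift_Suc_antimono_le[of "\<lambda>k. f (x k)"] decr that by blast
  moreover have sub: "{x k | k. 1 \<le> k \<and> enat k \<le> K} \<subseteq> sublevel_set f (f x0)"
    using iterates(1) by blast
  moreover have "bounded {x k | k. 1 \<le> k \<and> enat k \<le> K}"
    using level_bounded sub by (rule bounded_subset)
  moreover have "\<exists>m. K = enat m \<and> norm (g m) < \<epsilon>\<^sub>G \<and> K\<^sub>0 < m"
    unfolding K_eq g_eq
  proof (rule phase1_halts)
    show "0 < \<mu>\<^sub>1 * \<alpha>\<^sub>1 ^ J" using \<mu>\<^sub>1_bounds \<alpha>\<^sub>1_bounds by simp
  qed (use \<epsilon>\<^sub>G_pos iterates(2) nonneg in auto)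
  ultimately show ?thesis using level_bounded by auto
qed

end
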